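(* Let $\{F_n\}_{n\in\mathbb{N}}$ be the sequence of Fibonacci numbers. There exist a constant $c>0$ and an integer $N_0$ such that for all integers $N\geq N_0$, $$\#\left\{3\leq n\leq N : \Omega(F_n)\leq \frac{n}{\log\log n}\right\}\geq c\,\frac{N}{\log\log N}.$$
   Context: $F_n=\frac{\phi^n-(-\phi)^{-n}}{\sqrt5}$, where $\phi=\frac{1+\sqrt5}{2}$ is the golden ratio. For a positive integer $m$, $\Omega(m)$ is the number of prime factors of $m$ counted with multiplicity. *)

theory Defs
  imports "HOL-Analysis.Analysis" "HOL-Number_Theory.Number_Theory"
begin

definition bigomega :: "nat \<Rightarrow> nat" where
  "bigomega m = size (prime_factorization m)"

definition golden_ratio :: real where
  "golden_ratio = (1 + sqrt 5) / 2"

text \<open>The sequence is the library function \<^const>\<open>fib\<close>, which satisfies the Binet formula:\<close>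

lemma fib_binet:
  "real (fib n) = (golden_ratio ^ n - (- golden_ratio) powi (- int n)) / sqrt 5"
proof -
  have "(1 + sqrt 5) * (1 - sqrt 5) = (- 4 :: real)"
    by (simp add: algebra_simps)
  moreover have "1 + sqrt 5 \<noteq> (0 :: real)"
    using real_sqrt_ge_zero[of 5] by linarith
  ultimately have "inverse (- golden_ratio) = (1 - sqrt 5) / 2"
    by (simp add: golden_ratio_def field_simps)
  hence "(- golden_ratio) powi (- int n) = ((1 - sqrt 5) / 2) ^ n"
    by (metis power_int_minus power_int_of_nat power_inverse)
  thus ?thesis
    using fib_closed_form[of n] by (simp add: golden_ratio_def)
qed

end

theory Submission
  imports Defs "HOL-Real_Asymp.Real_Asymp"
begin

text \<open>
  In fact \<open>\<Omega>(F\<^sub>n) \<le> n / log log n\<close> holds for all large \<open>n\<close>. Put \<open>y = \<lceil>log n\<rceil>\<close>. As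
  \<open>F\<^sub>n \<le> 2\<^sup>n\<close>, at most \<open>n log 2 / log y\<close> prime factors exceed \<open>y\<close>, and \<open>log 2 < 1\<close> leaves
  room for the others. If \<open>p\<^sup>2\<close> divides \<open>F\<^sub>d\<close>, then
  \<open>v\<^sub>p(F\<^sub>d\<^sub>m) = v\<^sub>p(F\<^sub>d) + v\<^sub>p(m)\<close>, and by the pigeonhole principle some \<open>d \<le> p\<^sup>4\<close> has
  this property. So every prime \<open>p \<le> y\<close> has multiplicity at most \<open>p\<^sup>4 + log\<^sub>2 n\<close> in
  \<open>F\<^sub>n\<close>, which adds up to a power of \<open>log n\<close>.
\<close>

section \<open>Growth and divisors of Fibonacci numbers\<close>

lemma fib_le_power2: "fib n \<le> 2 ^ n"
  by (induction n rule: fib.induct) auto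

text \<open>The recurrence runs backwards: equality of two consecutive residues descends from index
  \<open>i\<close> to index 0, where \<open>fib 0 = 0\<close>.\<close>

lemma cong_fib_shift_imp_dvd:
  assumes "[fib i = fib (i + k)] (mod q)" "[fib (Suc i) = fib (Suc (i + k))] (mod q)"
  shows "q dvd fib k"
  using assms
proof (induction i)
  case 0
  then show ?case
    by (metis add_0 cong_0_iff cong_sym fib0)
next
  case (Suc i)
  have "[fib (Suc i) + fib i = fib (Suc i) + fib (i + k)] (mod q)"
    using cong_trans[OF Suc.prems(2)] cong_add[OF cong_sym[OF Suc.prems(1)] cong_refl]
    by (simp add: cong_def)
  then have "[fib i = fib (i + k)] (mod q)"
    by (simp add: cong_add_lcancel_nat)
  with Suc show ?case
    by simp
qed

text \<open>Pigeonhole: \<open>q\<^sup>2 + 1\<close> pairs of consecutive residues modulo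
  \<open>q\<close> take at most \<open>q\<^sup>2\<close> values, and a repeated pair gives the index
  \<open>d\<close> as a difference.\<close>

lemma ex_dvd_fib:
  assumes "q > 0"
  shows "\<exists>d. 0 < d \<and> d \<le> q\<^sup>2 \<and> q dvd fib d"
proof -
  let ?f = "\<lambda>i. (fib i mod q, fib (Suc i) mod q)"
  have "?f ` {..q\<^sup>2} \<subseteq> {..<q} \<times> {..<q}"
    using assms by auto
  then have "card (?f ` {..q\<^sup>2}) \<le> card ({..<q} \<times> {..<q})"
    by (intro card_mono) auto
  also have "\<dots> < card {..q\<^sup>2}"
    by (simp add: power2_eq_square)
  finally have "\<not> inj_on ?f {..q\<^sup>2}"
    by (rule pigeonhole)
  then obtain i j where ij: "i < j" "j \<le> q\<^sup>2" "?f i = ?f j"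
    unfolding inj_on_def by (metis atMost_iff linorder_neqE_nat)
  then have "q dvd fib (j - i)"
    by (intro cong_fib_shift_imp_dvd[of i]) (auto simp: cong_def)
  with ij show ?thesis
    by (intro exI[of _ "j - i"]) auto
qed

section \<open>Lifting the exponent for Fibonacci numbers\<close>

text \<open>
  The binomial expansion of \<open>F\<^sub>d\<^sub>m\<close> in \<open>F\<^sub>d\<close> and \<open>F\<^bsub>d-1\<^esub>\<close>, truncated modulo \<open>F\<^sub>d\<^sup>2\<close>. The factor
  \<open>u\<close> on the left avoids the exponent \<open>m - 1\<close>.
\<close>

lemma fib_mult_expand:
  fixes e m :: nat
  defines "x \<equiv> fib (Suc e)" and "u \<equiv> fib e"
  shows "\<exists>k l. fib (Suc e * m) * u = x * (m * u ^ m + k * x) \<and> fib (Suc (Suc e * m)) = u ^ m + l * x"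
proof (induction m)
  case 0
  show ?case
    by (intro exI[of _ 0]) simp
next
  case (Suc m)
  then obtain k l where k: "fib (Suc e * m) * u = x * (m * u ^ m + k * x)"
    and l: "fib (Suc (Suc e * m)) = u ^ m + l * x"
    by blast
  \<comment> \<open>Both indices take the form \<open>Suc (n + k)\<close> with
    \<open>k = Suc e * m\<close>, to which the addition formula \<open>fib_add\<close>
    applies.\<close>
  have idx: "Suc e * Suc m = Suc (e + Suc e * m)" "Suc (Suc e * Suc m) = Suc (Suc e + Suc e * m)"
    by simp_all
  have "fib (Suc e * Suc m) * u = (fib (Suc (Suc e * m)) * x + fib (Suc e * m) * u) * u"
    unfolding idx(1) fib_add by (simp only: x_def u_def)
  also have "\<dots> = x * (Suc m * u ^ Suc m + (l * u + k * u) * x)"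
    unfolding k l by (simp add: algebra_simps)
  finally have 1: "fib (Suc e * Suc m) * u = x * (Suc m * u ^ Suc m + (l * u + k * u) * x)" .
  have "fib (Suc (Suc e * Suc m)) = fib (Suc (Suc e * m)) * (x + u) + fib (Suc e * m) * x"
    unfolding idx(2) fib_add by (simp only: x_def u_def fib2)
  also have "\<dots> = u ^ Suc m + (u ^ m + l * x + l * u + fib (Suc e * m)) * x"
    unfolding l by (simp add: algebra_simps)
  finally show ?case
    using 1 by blast
qed

text \<open>In the expansion \<open>x * (m * u ^ m + k * x)\<close>, \<open>p\<close> does not
  divide \<open>u\<close>, since consecutive Fibonacci numbers are coprime. So the first summand has
  multiplicity that of \<open>m\<close>, which is less than that of \<open>x\<close>, and it decides
  the multiplicity of the sum.\<close>

lemma multiplicity_fib_mult_less: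
  assumes "prime p" "d > 0" "m > 0" "multiplicity p m < multiplicity p (fib d)"
  shows "multiplicity p (fib (d * m)) = multiplicity p (fib d) + multiplicity p m"
proof -
  obtain e where d: "d = Suc e"
    using assms(2) gr0_implies_Suc by blast
  define x u where "x = fib d" and "u = fib e"
  obtain k where k: "fib (d * m) * u = x * (m * u ^ m + k * x)"
    using fib_mult_expand[of e m] unfolding x_def u_def d by blast
  have pe: "prime_elem p"
    using assms(1) by simp
  have "x > 0" "fib (d * m) > 0"
    using assms(2,3) by (simp_all add: x_def fib_neq_0_nat)
  have "p dvd x"
    using assms(4) unfolding x_def by (metis not_dvd_imp_multiplicity_0 not_less_zero)
  moreover have "coprime u x"
    unfolding u_def x_def d by (rule coprime_fib_Suc_nat)
  ultimately have "\<not> p dvd u"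
    using assms(1) by (meson coprime_common_divisor not_prime_unit)
  then have u: "u > 0" "multiplicity p u = 0" "multiplicity p (u ^ m) = 0"
    using assms(1) by (auto intro!: Nat.gr0I not_dvd_imp_multiplicity_0 dest: prime_dvd_power)
  then have mu: "multiplicity p (m * u ^ m) = multiplicity p m"
    using assms(3) pe by (simp add: prime_elem_multiplicity_mult_distrib)
  have "multiplicity p (m * u ^ m + k * x) = multiplicity p m"
  \<comment> \<open>By convention \<open>multiplicity p 0 = 0\<close>, so the comparison of the two
    summands needs \<open>k * x\<close> to be nonzero.\<close>
  proof (cases "k = 0")
    case False
    then have "multiplicity p (m * u ^ m) < multiplicity p (k * x)"
      using mu assms(4) pe \<open>x > 0\<close> by (simp add: prime_elem_multiplicity_mult_distrib x_def)
    then show ?thesis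
      using mu multiplicity_sum_lt[of p "m * u ^ m" "k * x"] False \<open>x > 0\<close> assms(3) u(1) by simp
  qed (use mu in simp)
  moreover have "multiplicity p (fib (d * m) * u) = multiplicity p (fib (d * m))"
    using u \<open>fib (d * m) > 0\<close> pe by (simp add: prime_elem_multiplicity_mult_distrib)
  moreover have "multiplicity p (x * (m * u ^ m + k * x)) =
      multiplicity p x + multiplicity p (m * u ^ m + k * x)"
    using \<open>x > 0\<close> u(1) assms(3) pe by (intro prime_elem_multiplicity_mult_distrib) auto
  ultimately show ?thesis
    using k x_def by metis
qed

text \<open>The factors \<open>p\<close> of \<open>m\<close> are moved into \<open>d\<close> one at
  a time, each by the previous lemma with multiplier \<open>p\<close>; this needs multiplicity at
  least 2 in \<open>fib d\<close>. With only \<open>p dvd fib d\<close> the formula fails for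
  \<open>p = 2\<close>: \<open>fib 3 = 2\<close> but \<open>fib 6 = 8\<close>.\<close>

lemma multiplicity_fib_mult:
  assumes "prime p" "d > 0" "m > 0" "p\<^sup>2 dvd fib d"
  shows "multiplicity p (fib (d * m)) = multiplicity p (fib d) + multiplicity p m"
  using assms
proof (induction m arbitrary: d rule: less_induct)
  case (less m)
  have pe: "prime_elem p" and p1: "p > 1"
    using less.prems(1) prime_gt_1_nat by auto
  have 2: "multiplicity p (fib d) \<ge> 2"
    using less.prems p1 by (intro multiplicity_geI) (auto dest: fib_neq_0_nat)
  show ?case
  proof (cases "p dvd m")
    case False
    then show ?thesis
      using 2 less.prems by (intro multiplicity_fib_mult_less) (auto simp: not_dvd_imp_multiplicity_0)
  next
    case True
    then obtain m' where m': "m = p * m'" by blast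
    have "m' > 0" "m' < m"
      using less.prems(3) p1 m' by auto
    have "fib d dvd fib (d * p)"
      by (metis dvd_triv_left fib_gcd gcd_nat.absorb_iff1)
    then have "p\<^sup>2 dvd fib (d * p)"
      using less.prems(4) dvd_trans by blast
    then have "multiplicity p (fib (d * p * m')) = multiplicity p (fib (d * p)) + multiplicity p m'"
      using less.prems p1 \<open>m' > 0\<close> \<open>m' < m\<close> by (intro less.IH) auto
    also have "multiplicity p (fib (d * p)) = multiplicity p (fib d) + 1"
      using multiplicity_fib_mult_less[of p d p] 2 less.prems pe p1 by simp
    finally have "multiplicity p (fib (d * m)) = multiplicity p (fib d) + 1 + multiplicity p m'"
      by (simp add: m' mult.assoc)
    moreover have "multiplicity p m = multiplicity p m' + 1"
      using m' pe \<open>m' > 0\<close> by (simp add: prime_elem_multiplicity_mult_distrib)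
    ultimately show ?thesis
      by simp
  qed
qed

section \<open>Multiplicity of a single prime in a Fibonacci number\<close>

lemma multiplicity_le_log2:
  assumes "prime p" "n > 0"
  shows "real (multiplicity p n) \<le> log 2 (real n)"
proof -
  have "2 ^ multiplicity p n \<le> p ^ multiplicity p n"
    using prime_ge_2_nat[OF assms(1)] by (rule power_mono) simp
  also have "\<dots> \<le> n"
    using assms(2) by (intro dvd_imp_le multiplicity_dvd)
  finally show ?thesis
    using assms(2) by (simp add: le_log_of_power)
qed

lemma multiplicity_fib_le:
  assumes "prime p" "n > 0"
  shows "real (multiplicity p (fib n)) \<le> real p ^ 4 + log 2 (real n)"
proof (cases "p\<^sup>2 dvd fib n")
  case False
  have p1: "p > 1"
    using assms(1) by (rule prime_gt_1_nat)
  have "multiplicity p (fib n) < 2"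
    using False by (intro multiplicity_lessI) (use assms p1 in \<open>auto dest: fib_neq_0_nat\<close>)
  moreover have "real p ^ 4 \<ge> 1" "log 2 (real n) \<ge> 0"
    using p1 assms(2) by auto
  ultimately show ?thesis by linarith
next
  case True
  have p0: "p > 0"
    using assms(1) by (rule prime_gt_0_nat)
  obtain d where d: "d > 0" "d \<le> p ^ 4" "p\<^sup>2 dvd fib d"
    using ex_dvd_fib[of "p\<^sup>2"] p0 by (auto simp flip: power_mult)
  \<comment> \<open>The index \<open>d\<close> need not divide \<open>n\<close>. Since
    \<open>fib\<close> commutes with gcd, \<open>g\<close> does divide \<open>n\<close> and
    \<open>fib g\<close> is still divisible by \<open>p\<^sup>2\<close>.\<close>
  define g where "g = gcd d n"
  have "g \<le> p ^ 4"
    unfolding g_def using d(1,2) le_trans[OF gcd_le1_nat] by blast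
  then have g: "g > 0" "g \<le> p ^ 4" "p\<^sup>2 dvd fib g"
    using d True by (simp_all add: g_def fib_gcd)
  obtain m where m: "n = g * m"
    unfolding g_def by (meson dvdE gcd_dvd2)
  have "m > 0" using m assms by auto
  have "multiplicity p (fib n) = multiplicity p (fib g) + multiplicity p m"
    unfolding m using g \<open>m > 0\<close> assms by (intro multiplicity_fib_mult)
  moreover have "real (multiplicity p m) \<le> log 2 (real n)"
  proof -
    have "real (multiplicity p m) \<le> log 2 (real m)"
      using assms \<open>m > 0\<close> by (intro multiplicity_le_log2)
    also have "\<dots> \<le> log 2 (real n)"
      using m g \<open>m > 0\<close> by simp
    finally show ?thesis .
  qed
  moreover have "real (multiplicity p (fib g)) \<le> real p ^ 4"
  proof -
    have "real (multiplicity p (fib g)) \<le> log 2 (real (fib g))"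
      using assms g by (intro multiplicity_le_log2) (auto intro: fib_neq_0_nat)
    also have "\<dots> \<le> log 2 (2 ^ g)"
      using fib_le_power2[of g] fib_neq_0_nat[OF g(1)] by (intro log_mono) auto
    also have "\<dots> = real g" by simp
    also have "\<dots> \<le> real p ^ 4"
      using g(2) by (metis of_nat_le_iff of_nat_power)
    finally show ?thesis .
  qed
  ultimately show ?thesis by linarith
qed

section \<open>Counting prime factors below and above a threshold\<close>

lemma power_size_le_prod_mset:
  fixes M :: "nat multiset"
  assumes "\<And>x. x \<in># M \<Longrightarrow> y \<le> x"
  shows "y ^ size M \<le> prod_mset M"
  using assms
proof (induction M)
  case (add a M)
  then show ?case by (auto intro!: mult_le_mono)
qed simp

text \<open>At most \<open>y\<close> primes are at most \<open>y\<close>, each counted at most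
  \<open>B\<close> times; the remaining prime factors exceed \<open>y\<close>, and their product is
  at most \<open>m\<close>.\<close>

lemma bigomega_le:
  assumes "m > 0" "y \<ge> 2" "B \<ge> 0"
    and "\<And>p. prime p \<Longrightarrow> p \<le> y \<Longrightarrow> real (multiplicity p m) \<le> B"
  shows "real (bigomega m) \<le> real y * B + log (real y) (real m)"
proof -
  define M where "M = prime_factorization m"
  define S where "S = filter_mset (\<lambda>p. p \<le> y) M"
  define L where "L = filter_mset (\<lambda>p. \<not> p \<le> y) M"
  have "size M = size S + size L"
    unfolding S_def L_def by (metis multiset_partition size_union)
  moreover have "real (size S) \<le> real y * B"
  proof -
    have sub: "set_mset S \<subseteq> {1..y}"
      by (auto simp: S_def M_def dest!: in_prime_factors_imp_prime prime_ge_1_nat)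
    have "real (size S) = (\<Sum>p\<in>set_mset S. real (count S p))"
      by (simp add: size_multiset_overloaded_eq)
    also have "\<dots> \<le> (\<Sum>p\<in>set_mset S. B)"
      using assms(4) by (intro sum_mono) (auto simp: S_def M_def count_prime_factorization_prime in_prime_factors_imp_prime)
    also have "\<dots> \<le> real y * B"
      using card_mono[OF _ sub] assms(3) by (simp add: mult_right_mono)
    finally show ?thesis .
  qed
  moreover have "real (size L) \<le> log (real y) (real m)"
  proof -
    have "y ^ size L \<le> prod_mset L"
      by (intro power_size_le_prod_mset) (auto simp: L_def)
    also have "\<dots> \<le> prod_mset M"
    proof -
      have "prod_mset M = m"
        using assms(1) by (simp add: M_def prod_mset_prime_factorization_nat)
      moreover have "prod_mset L dvd prod_mset M"
        by (intro prod_mset_subset_imp_dvd) (simp add: L_def)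
      ultimately show ?thesis
        using assms(1) by (auto intro: dvd_imp_le)
    qed
    also have "\<dots> = m"
      using assms(1) by (simp add: M_def prod_mset_prime_factorization_nat)
    finally have "real y ^ size L \<le> real m"
      by (metis of_nat_le_iff of_nat_power)
    then show ?thesis
      using assms(1,2) by (intro le_log_of_power) auto
  qed
  ultimately show ?thesis
    by (simp add: bigomega_def M_def)
qed

lemma bigomega_fib_le:
  assumes "n > 0" "y \<ge> 2"
  shows "real (bigomega (fib n)) \<le> real y * (real y ^ 4 + log 2 (real n)) + real n * ln 2 / ln (real y)"
proof -
  have fib: "fib n > 0"
    using assms(1) by (rule fib_neq_0_nat)
  have "real (bigomega (fib n)) \<le> real y * (real y ^ 4 + log 2 (real n)) + log (real y) (real (fib n))"
  proof (rule bigomega_le)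
    show "real y ^ 4 + log 2 (real n) \<ge> 0"
      using assms(1) by simp
    fix p assume p: "prime p" "p \<le> y"
    have "real (multiplicity p (fib n)) \<le> real p ^ 4 + log 2 (real n)"
      using p(1) assms(1) by (rule multiplicity_fib_le)
    also have "real p ^ 4 \<le> real y ^ 4"
      using p(2) by (intro power_mono) auto
    finally show "real (multiplicity p (fib n)) \<le> real y ^ 4 + log 2 (real n)"
      by simp
  qed (use fib assms in auto)
  also have "log (real y) (real (fib n)) \<le> log (real y) (2 ^ n)"
    using assms(2) fib fib_le_power2[of n] by (intro log_mono) auto
  also have "\<dots> = real n * ln 2 / ln (real y)"
    by (simp add: log_def ln_realpow)
  finally show ?thesis
    by simp
qed

section \<open>Asymptotics and the final count\<close>

lemma eventually_bigomega_fib_le: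
  "eventually (\<lambda>n. real (bigomega (fib n)) \<le> real n / ln (ln (real n))) at_top"
proof -
  \<comment> \<open>The left side is polylogarithmic, so any positive constant would do. The value
    3/10 is what the large primes leave over, as \<open>ln 2 \<le> 25/36 < 7/10\<close>.\<close>
  have "eventually (\<lambda>n. (ln (real n) + 1) * ((ln (real n) + 1) ^ 4 + log 2 (real n))
      \<le> 3 / 10 * (real n / ln (ln (real n)))) at_top"
    by real_asymp
  moreover have "eventually (\<lambda>n. ln (real n) \<ge> 2) at_top"
    by real_asymp
  moreover have "eventually (\<lambda>n::nat. n > 0) at_top"
    by (rule eventually_gt_at_top)
  ultimately show ?thesis
  proof eventually_elim
    case (elim n)
    \<comment> \<open>Rounding up gives \<open>ln (ln n) \<le> ln y\<close>, the direction needed in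
      the denominator, and costs at most 1 in the other term.\<close>
    define y where "y = nat \<lceil>ln (real n)\<rceil>"
    have y: "ln (real n) \<le> real y" "real y \<le> ln (real n) + 1"
      using elim(2) unfolding y_def by linarith+
    then have "y \<ge> 2"
      using elim(2) by linarith
    have lnln: "0 < ln (ln (real n))" "ln (ln (real n)) \<le> ln (real y)"
      using y(1) elim(2) by simp_all
    have "real (bigomega (fib n)) \<le> real y * (real y ^ 4 + log 2 (real n)) + real n * ln 2 / ln (real y)"
      using elim(3) \<open>y \<ge> 2\<close> by (rule bigomega_fib_le)
    also have "real y * (real y ^ 4 + log 2 (real n))
        \<le> (ln (real n) + 1) * ((ln (real n) + 1) ^ 4 + log 2 (real n))"
      using y elim by (intro mult_mono add_mono power_mono) auto
    also have "\<dots> \<le> 3 / 10 * (real n / ln (ln (real n)))"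
      by (rule elim(1))
    also have "real n * ln 2 / ln (real y) \<le> real n * (7 / 10) / ln (ln (real n))"
      using lnln ln2_le_25_over_36 by (intro frac_le mult_left_mono) auto
    finally show ?case
      by (simp add: field_simps)
  qed
qed

theorem corollary1p3:
  shows "\<exists>(c::real) (N0::nat). c > 0 \<and>
    (\<forall>N::nat. N \<ge> N0 \<longrightarrow>
      real (card {n::nat. 3 \<le> n \<and> n \<le> N \<and>
                    real (bigomega (fib n)) \<le> real n / ln (ln (real n))})
        \<ge> c * (real N / ln (ln (real N))))"
proof -
  obtain n0 where n0: "\<And>n. n \<ge> n0 \<Longrightarrow> real (bigomega (fib n)) \<le> real n / ln (ln (real n))"
    using eventually_bigomega_fib_le unfolding eventually_at_top_linorder by blast
  \<comment> \<open>Beyond this point \<open>N / ln (ln N) \<le> N\<close>, so a positive proportion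
    of good \<open>n\<close> suffices.\<close>
  have "eventually (\<lambda>N. ln (ln (real N)) \<ge> 1) at_top"
    by real_asymp
  then obtain n1 where n1: "\<And>N. N \<ge> n1 \<Longrightarrow> ln (ln (real N)) \<ge> 1"
    unfolding eventually_at_top_linorder by blast
  define m where "m = max n0 3"
  have "real (card {n. 3 \<le> n \<and> n \<le> N \<and> real (bigomega (fib n)) \<le> real n / ln (ln (real n))})
      \<ge> 1 / 2 * (real N / ln (ln (real N)))" (is "real (card ?A) \<ge> _")
    \<comment> \<open>For \<open>N \<ge> 2 * m\<close> the interval \<open>{m..N}\<close>, all of
      whose elements are good, has more than \<open>N / 2\<close> elements.\<close>
    if N: "N \<ge> max n1 (2 * m)" for N
  proof -
    have "1 / 2 * (real N / ln (ln (real N))) \<le> 1 / 2 * (real N / 1)"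
      using n1[of N] N by (intro mult_left_mono divide_left_mono) auto
    also have "\<dots> \<le> real (card {m..N})"
      using N by (simp add: of_nat_diff)
    also have "card {m..N} \<le> card ?A"
      using n0 by (intro card_mono finite_subset[of ?A "{..N}"]) (auto simp: m_def)
    finally show ?thesis
      by simp
  qed
  then show ?thesis
    by (intro exI[of _ "1 / 2"] exI[of _ "max n1 (2 * m)"]) auto
qed

end
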